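(* Let $G$ be a (finite simple undirected) graph. The following are equivalent: (a) $G$ is the competition-common enemy graph of a semiorder; (b) $G$ is the competition-common enemy graph of an interval order; (c) $G$ is (isomorphic to) $K_r \cup I_q$, the disjoint union of a complete graph on $r$ vertices and an edgeless graph on $q$ vertices, for some nonnegative integers $r,q$, where if $r \geq 2$ then $q \geq 2$.
   Context: All digraphs are finite. For a digraph $D$ and a vertex $x$, $N^+_D(x)=\{v \mid (x,v)\in A(D)\}$ is the set of out-neighbors and $N^-_D(x)=\{v \mid (v,x)\in A(D)\}$ the set of in-neighbors of $x$. The competition-common enemy graph of $D$ is the simple undirected graph with vertex set $V(D)$ in which two distinct vertices $x,y$ are adjacent if and only if both $N^+_D(x)\cap N^+_D(y)\neq\emptyset$ and $N^-_D(x)\cap N^-_D(y)\neq\emptyset$. A digraph $D=(V,A)$ is a semiorder if there exist a function $f:V\to\mathbb{R}$ and a real $\delta>0$ such that $(x,y)\in A$ if and only if $f(x)>f(y)+\delta$. A digraph $D=(V,A)$ is an interval order if there is an assignment of a closed real interval $J(x)\subset\mathbb{R}$ to each $x\in V$ such that $(x,y)\in A$ if and only if $\min J(x)>\max J(y)$. $K_r$ denotes the complete graph on $r$ vertices and $I_q$ the graph with $q$ vertices and no edges. *)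

theory Defs
  imports
    Complex_Main
    "HOL-Library.Interval"
    "Graph_Theory.Graph_Theory"
begin

text \<open>
  A digraph \<open>D = (V, A)\<close> is an \<^typ>\<open>'a pair_pre_digraph\<close> satisfying
  \<^locale>\<open>pair_fin_digraph\<close>; loops are permitted and \<open>V\<close> may be empty.
  As in the underlying library, a finite simple undirected graph is a finite, loopfree,
  symmetric digraph without parallel arcs, i.e. a \<^locale>\<open>pair_graph\<close>: an edge \<open>xy\<close> is
  the pair of arcs \<open>(x, y)\<close>, \<open>(y, x)\<close>.
\<close>

definition out_neighbors :: "'a pair_pre_digraph \<Rightarrow> 'a \<Rightarrow> 'a set" where
  "out_neighbors D x = {v. (x, v) \<in> parcs D}"

definition in_neighbors :: "'a pair_pre_digraph \<Rightarrow> 'a \<Rightarrow> 'a set" where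
  "in_neighbors D x = {v. (v, x) \<in> parcs D}"

definition cce_graph :: "'a pair_pre_digraph \<Rightarrow> 'a pair_pre_digraph" where
  "cce_graph D = \<lparr> pverts = pverts D,
     parcs = {(x, y). x \<in> pverts D \<and> y \<in> pverts D \<and> x \<noteq> y
       \<and> out_neighbors D x \<inter> out_neighbors D y \<noteq> {}
       \<and> in_neighbors D x \<inter> in_neighbors D y \<noteq> {}} \<rparr>"

lemma pair_graph_cce_graph:
  assumes "pair_fin_digraph D"
  shows "pair_graph (cce_graph D)"
proof -
  interpret D: pair_fin_digraph D by fact
  have "parcs (cce_graph D) \<subseteq> pverts D \<times> pverts D"
    by (auto simp: cce_graph_def)
  then have fin: "finite (parcs (cce_graph D))"
    using D.pair_finite_verts finite_subset by blast
  have "symmetric (with_proj (cce_graph D))"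
    by (auto simp: symmetric_def cce_graph_def sym_def)
  with fin show ?thesis
    using D.pair_finite_verts by unfold_locales (auto simp: cce_graph_def)
qed

definition semiorder :: "'a pair_pre_digraph \<Rightarrow> bool" where
  "semiorder D \<longleftrightarrow> (\<exists>(f :: 'a \<Rightarrow> real) (\<delta> :: real). \<delta> > 0 \<and>
     (\<forall>x \<in> pverts D. \<forall>y \<in> pverts D. (x, y) \<in> parcs D \<longleftrightarrow> f x > f y + \<delta>))"

text \<open>
  The values of \<^typ>\<open>real interval\<close> are the nonempty compact intervals; \<^term>\<open>lower I\<close> and
  \<^term>\<open>upper I\<close> are the minimum and the maximum of \<open>I\<close>.
\<close>

definition interval_order :: "'a pair_pre_digraph \<Rightarrow> bool" where
  "interval_order D \<longleftrightarrow> (\<exists>J :: 'a \<Rightarrow> real interval.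
     \<forall>x \<in> pverts D. \<forall>y \<in> pverts D. (x, y) \<in> parcs D \<longleftrightarrow> lower (J x) > upper (J y))"

definition complete_graph :: "nat \<Rightarrow> nat pair_pre_digraph" where
  "complete_graph r = \<lparr> pverts = {..<r}, parcs = {(i, j). i < r \<and> j < r \<and> i \<noteq> j} \<rparr>"

lemma complete_digraph_complete_graph: "complete_digraph r (with_proj (complete_graph r))"
  by (auto simp: complete_digraph_pair_def complete_graph_def)

definition edgeless_graph :: "nat \<Rightarrow> nat pair_pre_digraph" where
  "edgeless_graph q = \<lparr> pverts = {..<q}, parcs = {} \<rparr>"

text \<open>
  The library's \<^const>\<open>union\<close> identifies common vertices, so the two vertex sets are
  separated by tagging.
\<close>

definition disjoint_union ::
    "'a pair_pre_digraph \<Rightarrow> 'b pair_pre_digraph \<Rightarrow> ('a + 'b) pair_pre_digraph" where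
  "disjoint_union G H = \<lparr> pverts = pverts G <+> pverts H,
     parcs = map_prod Inl Inl ` parcs G \<union> map_prod Inr Inr ` parcs H \<rparr>"

end

theory Submission
  imports Defs
begin

text \<open>
  In an interval order, let \<open>K\<close> be the set of vertices having both an out-neighbour and an
  in-neighbour. Of the out-neighbours of two vertices in \<open>K\<close>, the one whose interval ends first is
  common to both; dually for in-neighbours. So the competition-common enemy graph is complete on
  \<open>K\<close> and has no other edges. If \<open>K\<close> is nonempty, an interval with least right end and one with
  greatest left end are two distinct vertices outside \<open>K\<close>. Conversely, if at least two vertices are
  isolated, put one of them at \<open>-2\<close>, the remaining isolated ones at \<open>2\<close> and the clique at \<open>0\<close>,
  with threshold \<open>1\<close>.
\<close>

text \<open>An isomorphism in the library carries separate maps for vertices, arcs, heads and tails.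
  Between pair digraphs the arc map is forced by the vertex map, because tail and head are the two
  projections.\<close>

lemma digraph_iso_with_proj_iff:
  assumes "pair_wf_digraph G"
  shows "digraph_iso (with_proj G) (with_proj H) \<longleftrightarrow>
    (\<exists>h. bij_betw h (pverts G) (pverts H) \<and> parcs H = map_prod h h ` parcs G)"
proof
  assume "digraph_iso (with_proj G) (with_proj H)"
  then obtain f where f: "pre_digraph.digraph_isomorphism (with_proj G) f"
    and H: "with_proj H = app_iso f (with_proj G)"
    by (auto simp: digraph_iso_def)
  have V: "pverts H = iso_verts f ` pverts G" and A: "parcs H = iso_arcs f ` parcs G"
    and t: "iso_tail f = fst" and h: "iso_head f = snd"
    using arg_cong[OF H, of verts] arg_cong[OF H, of arcs]
      arg_cong[OF H, of tail] arg_cong[OF H, of head] by simp_all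
  have "iso_arcs f a = map_prod (iso_verts f) (iso_verts f) a" if "a \<in> parcs G" for a
    using f that by (simp add: pre_digraph.digraph_isomorphism_def t h prod_eq_iff)
  then have "parcs H = map_prod (iso_verts f) (iso_verts f) ` parcs G"
    unfolding A by (rule image_cong[OF refl])
  moreover have "bij_betw (iso_verts f) (pverts G) (pverts H)"
    using f V by (simp add: pre_digraph.digraph_isomorphism_def bij_betw_def)
  ultimately show "\<exists>h. bij_betw h (pverts G) (pverts H) \<and> parcs H = map_prod h h ` parcs G"
    by blast
next
  assume "\<exists>h. bij_betw h (pverts G) (pverts H) \<and> parcs H = map_prod h h ` parcs G"
  then obtain h where inj: "inj_on h (pverts G)" and V: "pverts H = h ` pverts G"
    and A: "parcs H = map_prod h h ` parcs G"
    by (auto simp: bij_betw_def)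
  interpret G: pair_wf_digraph G by fact
  define f where
    "f = \<lparr>iso_verts = h, iso_arcs = map_prod h h, iso_head = snd, iso_tail = fst\<rparr>"
  \<comment> \<open>Injectivity of \<open>h\<close> is known on vertices only; it passes to arcs
    because their ends are vertices.\<close>
  have "parcs G \<subseteq> pverts G \<times> pverts G"
    by (auto dest: G.in_arcsD1 G.in_arcsD2)
  then have "inj_on (map_prod h h) (parcs G)"
    using map_prod_inj_on[OF inj inj] inj_on_subset by blast
  then have "pre_digraph.digraph_isomorphism (with_proj G) f"
    using inj assms by (simp add: pre_digraph.digraph_isomorphism_def f_def wf_digraph_wp_iff)
  moreover have "with_proj H = app_iso f (with_proj G)"
    by (simp add: with_proj_def app_iso_def f_def V A)
  ultimately show "digraph_iso (with_proj G) (with_proj H)"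
    by (auto simp: digraph_iso_def)
qed

lemma pverts_clique_isolated:
  "pverts (disjoint_union (complete_graph r) (edgeless_graph q)) = {..<r} <+> {..<q}"
  by (simp add: disjoint_union_def complete_graph_def edgeless_graph_def)

lemma parcs_clique_isolated:
  "parcs (disjoint_union (complete_graph r) (edgeless_graph q))
    = Inl ` {..<r} \<times> Inl ` {..<r} - Id"
  by (force simp: disjoint_union_def complete_graph_def edgeless_graph_def)

text \<open>Injectivity keeps pairs off the diagonal off the diagonal, so the image of a clique
  gains no loops and loses no edges.\<close>

lemma map_prod_image_clique:
  assumes "inj_on h K"
  shows "map_prod h h ` (K \<times> K - Id) = h ` K \<times> h ` K - Id"
  using assms by (auto simp: inj_on_def)

text \<open>Moves condition (c) into \<open>G\<close> itself: \<open>K\<close> is the part of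
  \<open>G\<close> matched with the clique, and only its size and that of its complement
  matter.\<close>

lemma digraph_iso_clique_isolated_iff:
  assumes "pair_fin_digraph G"
  shows "digraph_iso (with_proj G)
      (with_proj (disjoint_union (complete_graph r) (edgeless_graph q))) \<longleftrightarrow>
    (\<exists>K\<subseteq>pverts G. parcs G = K \<times> K - Id \<and> card K = r \<and> card (pverts G - K) = q)"
    (is "?iso \<longleftrightarrow> ?R")
proof -
  interpret G: pair_fin_digraph G by fact
  have wf: "pair_wf_digraph G" by unfold_locales
  show ?thesis
  proof
    assume ?iso
    then obtain h where h: "bij_betw h (pverts G) ({..<r} <+> {..<q})"
      and A: "Inl ` {..<r} \<times> Inl ` {..<r} - Id = map_prod h h ` parcs G"
      unfolding digraph_iso_with_proj_iff[OF wf] pverts_clique_isolated parcs_clique_isolated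
      by blast
    define K where "K = {x \<in> pverts G. h x \<in> Inl ` {..<r}}"
    have K: "K \<subseteq> pverts G" by (auto simp: K_def)
    have inj: "inj_on h (pverts G)" using h by (rule bij_betw_imp_inj_on)
    have hK: "h ` K = Inl ` {..<r}"
    proof -
      have "h ` K = h ` pverts G \<inter> Inl ` {..<r}" by (auto simp: K_def)
      then show ?thesis using bij_betw_imp_surj_on[OF h] by auto
    qed
    have hKc: "h ` (pverts G - K) = Inr ` {..<q}"
      using bij_betw_imp_surj_on[OF h] inj_on_image_set_diff[OF inj _ K, of "pverts G"] hK
      by auto
    have "map_prod h h ` parcs G = map_prod h h ` (K \<times> K - Id)"
      using A map_prod_image_clique[OF inj_on_subset[OF inj K]] hK by simp
    \<comment> \<open>Injectivity on all pairs of vertices allows the map to be cancelled from the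
      two equal images.\<close>
    moreover have "inj_on (map_prod h h) (pverts G \<times> pverts G)"
      using inj by (rule map_prod_inj_on[OF _ inj])
    moreover have "parcs G \<subseteq> pverts G \<times> pverts G" "K \<times> K - Id \<subseteq> pverts G \<times> pverts G"
      using K by (auto dest: G.in_arcsD1 G.in_arcsD2)
    ultimately have "parcs G = K \<times> K - Id"
      by (simp add: inj_on_image_eq_iff)
    moreover have "card K = r"
      using card_image[OF inj_on_subset[OF inj K]] by (simp add: hK card_image)
    moreover have "card (pverts G - K) = q"
      using card_image[OF inj_on_subset[OF inj Diff_subset], of K] by (simp add: hKc card_image)
    ultimately show ?R using K by blast
  next
    assume ?R
    then obtain K where K: "K \<subseteq> pverts G" and A: "parcs G = K \<times> K - Id"
      and r: "card K = r" and q: "card (pverts G - K) = q"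
      by blast
    obtain f where f: "bij_betw f K {..<r}"
      using finite_same_card_bij[of K "{..<r}"] finite_subset[OF K] r by auto
    obtain g where g: "bij_betw g (pverts G - K) {..<q}"
      using finite_same_card_bij[of "pverts G - K" "{..<q}"] q by auto
    define h :: "'a \<Rightarrow> nat + nat" where "h x = (if x \<in> K then Inl (f x) else Inr (g x))" for x
    have hK: "h ` K = Inl ` {..<r}"
      using bij_betw_imp_surj_on[OF f] by (simp add: h_def flip: image_image[of Inl f])
    have hKc: "h ` (pverts G - K) = Inr ` {..<q}"
      using bij_betw_imp_surj_on[OF g] by (simp add: h_def flip: image_image[of Inr g])
    have inj: "inj_on h (pverts G)"
      using bij_betw_imp_inj_on[OF f] bij_betw_imp_inj_on[OF g]
      by (auto simp: inj_on_def h_def)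
    have "h ` pverts G = h ` K \<union> h ` (pverts G - K)"
      using K by blast
    then have "bij_betw h (pverts G) ({..<r} <+> {..<q})"
      using inj by (simp add: bij_betw_def hK hKc Plus_def)
    moreover have "Inl ` {..<r} \<times> Inl ` {..<r} - Id = map_prod h h ` parcs G"
      using map_prod_image_clique[OF inj_on_subset[OF inj K]] by (simp add: A hK)
    ultimately show ?iso
      unfolding digraph_iso_with_proj_iff[OF wf] pverts_clique_isolated parcs_clique_isolated
      by blast
  qed
qed

lemma semiorder_imp_interval_order:
  assumes "semiorder D"
  shows "interval_order D"
proof -
  obtain f :: "'a \<Rightarrow> real" and d where d: "d > 0"
    and arc: "\<forall>x\<in>pverts D. \<forall>y\<in>pverts D. (x, y) \<in> parcs D \<longleftrightarrow> f x > f y + d"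
    using assms unfolding semiorder_def by blast
  \<comment> \<open>All intervals have the common length \<open>d\<close>. Since \<open>d\<close> is
    positive, the ends are in the right order and \<open>Ivl\<close> keeps them.\<close>
  define J where "J x = Ivl (f x) (f x + d)" for x
  have "lower (J x) = f x" "upper (J x) = f x + d" for x
    using d by (simp_all add: J_def lower.rep_eq upper.rep_eq Ivl.rep_eq)
  with arc show ?thesis
    unfolding interval_order_def by (intro exI[of _ J]) simp
qed

lemma cce_graph_interval_order:
  assumes "pair_fin_digraph D" "interval_order D"
  obtains K where "K \<subseteq> pverts D" "parcs (cce_graph D) = K \<times> K - Id"
    "2 \<le> card K \<longrightarrow> 2 \<le> card (pverts D - K)"
proof -
  interpret D: pair_fin_digraph D by fact
  let ?V = "pverts D"
  obtain J :: "'a \<Rightarrow> real interval" where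
    "\<forall>x\<in>?V. \<forall>y\<in>?V. (x, y) \<in> parcs D \<longleftrightarrow> lower (J x) > upper (J y)"
    using assms(2) unfolding interval_order_def by blast
  then have arc: "(x, y) \<in> parcs D \<longleftrightarrow> x \<in> ?V \<and> y \<in> ?V \<and> upper (J y) < lower (J x)" for x y
    by (auto dest: D.in_arcsD1 D.in_arcsD2)
  define K where "K = {x \<in> ?V. out_neighbors D x \<noteq> {} \<and> in_neighbors D x \<noteq> {}}"
  have out: "out_neighbors D x \<inter> out_neighbors D y \<noteq> {}" if "x \<in> K" "y \<in> K" for x y
  proof -
    from that obtain u v where "(x, u) \<in> parcs D" "(y, v) \<in> parcs D"
      by (auto simp: K_def out_neighbors_def)
    then have "(y, u) \<in> parcs D \<or> (x, v) \<in> parcs D"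
      unfolding arc by linarith
    with \<open>(x, u) \<in> parcs D\<close> \<open>(y, v) \<in> parcs D\<close> show ?thesis
      by (auto simp: out_neighbors_def)
  qed
  have "in": "in_neighbors D x \<inter> in_neighbors D y \<noteq> {}" if "x \<in> K" "y \<in> K" for x y
  proof -
    from that obtain u v where "(u, x) \<in> parcs D" "(v, y) \<in> parcs D"
      by (auto simp: K_def in_neighbors_def)
    then have "(u, y) \<in> parcs D \<or> (v, x) \<in> parcs D"
      unfolding arc by linarith
    with \<open>(u, x) \<in> parcs D\<close> \<open>(v, y) \<in> parcs D\<close> show ?thesis
      by (auto simp: in_neighbors_def)
  qed
  show thesis
  proof (rule that)
    show "K \<subseteq> ?V" by (auto simp: K_def)
    show "parcs (cce_graph D) = K \<times> K - Id"
    proof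
      show "parcs (cce_graph D) \<subseteq> K \<times> K - Id"
        by (auto simp: cce_graph_def K_def)
      show "K \<times> K - Id \<subseteq> parcs (cce_graph D)"
        using out "in" by (auto simp: cce_graph_def) (auto simp: K_def)
    qed
    show "2 \<le> card K \<longrightarrow> 2 \<le> card (?V - K)"
    proof
      assume "2 \<le> card K"
      then obtain x where x: "x \<in> K" by fastforce
      then have "?V \<noteq> {}" by (auto simp: K_def)
      then obtain a where a: "a \<in> ?V" "\<And>y. y \<in> ?V \<Longrightarrow> upper (J a) \<le> upper (J y)"
        using ex_min_if_finite[of "(\<lambda>x. upper (J x)) ` ?V"] by (auto simp: not_less)
      from \<open>?V \<noteq> {}\<close> obtain b where b: "b \<in> ?V" "\<And>y. y \<in> ?V \<Longrightarrow> lower (J y) \<le> lower (J b)"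
        using ex_min_if_finite[of "(\<lambda>x. - lower (J x)) ` ?V"] by (auto simp: not_less)
      \<comment> \<open>An interval ending strictly before \<open>J a\<close> begins would also end
        before \<open>J a\<close> ends, against the choice of \<open>a\<close>. The argument for
        \<open>b\<close> is dual.\<close>
      have "(a, y) \<notin> parcs D" for y
        using a(2)[of y] lower_le_upper[of "J a"] unfolding arc by linarith
      then have "a \<notin> K" by (auto simp: K_def out_neighbors_def)
      have "(y, b) \<notin> parcs D" for y
        using b(2)[of y] lower_le_upper[of "J b"] unfolding arc by linarith
      then have "b \<notin> K" by (auto simp: K_def in_neighbors_def)
      from x obtain u v where "(x, u) \<in> parcs D" "(v, x) \<in> parcs D"
        by (auto simp: K_def out_neighbors_def in_neighbors_def)
      \<comment> \<open>By minimality \<open>J a\<close> ends no later than \<open>J u\<close>,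
        hence before \<open>J x\<close> begins; \<open>J x\<close> ends before \<open>J v\<close>
        begins, and \<open>J b\<close> begins no earlier than \<open>J v\<close>.\<close>
      then have "upper (J a) < upper (J b)"
        using a(2)[of u] b(2)[of v] lower_le_upper[of "J x"] lower_le_upper[of "J b"]
        unfolding arc by linarith
      then have "a \<noteq> b" by blast
      then have "card {a, b} = 2" by simp
      moreover have "{a, b} \<subseteq> ?V - K" using a b \<open>a \<notin> K\<close> \<open>b \<notin> K\<close> by auto
      ultimately show "2 \<le> card (?V - K)"
        using card_mono[of "?V - K" "{a, b}"] by simp
    qed
  qed
qed

text \<open>Condition (a) asks for equality and not just isomorphism, so the semiorder is built on
  the given vertex set, with the given clique.\<close>

lemma semiorder_realization:
  assumes "finite V" "K \<subseteq> V" "2 \<le> card K \<longrightarrow> 2 \<le> card (V - K)"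
  obtains D where "pair_fin_digraph D" "semiorder D" "pverts D = V"
    "parcs (cce_graph D) = K \<times> K - Id"
proof (cases "2 \<le> card K")
  case False
  \<comment> \<open>With at most one vertex in \<open>K\<close> there is no edge to realize, and the
    digraph without arcs suffices.\<close>
  define D :: "'a pair_pre_digraph" where "D = \<lparr>pverts = V, parcs = {}\<rparr>"
  show thesis
  proof (rule that[of D])
    show "pair_fin_digraph D"
      using assms(1) by unfold_locales (auto simp: D_def)
    show "semiorder D"
      unfolding semiorder_def D_def by (intro exI[of _ "\<lambda>_. 0"] exI[of _ 1]) simp
    have "finite K" using assms(1,2) finite_subset by blast
    then have "K \<times> K - Id = {}"
      using False card_le_Suc0_iff_eq[of K] by auto
    then show "parcs (cce_graph D) = K \<times> K - Id"
      by (simp add: cce_graph_def D_def out_neighbors_def)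
  qed (simp add: D_def)
next
  case True
  with assms(3) have "2 \<le> card (V - K)" by blast
  then obtain a b where ab: "a \<in> V - K" "b \<in> V - K" "a \<noteq> b"
    using card_le_Suc0_iff_eq[of "V - K"] assms(1) by fastforce
  \<comment> \<open>Since \<open>a\<close> differs from \<open>b\<close>, it gets the value 2. The
    gaps of 2 exceed the threshold 1, so \<open>b\<close> is a common out-neighbour and
    \<open>a\<close> a common in-neighbour of all of \<open>K\<close>.\<close>
  define f :: "'a \<Rightarrow> real" where "f x = (if x \<in> K then 0 else if x = b then - 2 else 2)" for x
  define D where "D = \<lparr>pverts = V, parcs = {(x, y). x \<in> V \<and> y \<in> V \<and> f x > f y + 1}\<rparr>"
  have arc: "(x, y) \<in> parcs D \<longleftrightarrow> x \<in> V \<and> y \<in> V \<and> f x > f y + 1" for x y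
    by (simp add: D_def)
  have V: "pverts D = V" by (simp add: D_def)
  show thesis
  proof (rule that[of D])
    have "finite (parcs D)"
      by (rule finite_subset[of _ "V \<times> V"]) (use assms(1) in \<open>auto simp: arc\<close>)
    then show "pair_fin_digraph D"
      using assms(1) by unfold_locales (auto simp: V arc)
    show "semiorder D"
      unfolding semiorder_def V arc by (intro exI[of _ f] exI[of _ 1]) simp
    \<comment> \<open>The extreme values are excluded: nothing lies above 2 and nothing below -2, so
      \<open>x\<close> has the value 0.\<close>
    have K: "x \<in> K" if "(x, u) \<in> parcs D" "(v, x) \<in> parcs D" for x u v
      using that by (auto simp: arc f_def split: if_splits)
    have "b \<in> out_neighbors D x" "a \<in> in_neighbors D x" if "x \<in> K" for x
      using that ab assms(2) by (auto simp: out_neighbors_def in_neighbors_def arc f_def)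
    then have "K \<times> K - Id \<subseteq> parcs (cce_graph D)"
      using assms(2) by (fastforce simp: cce_graph_def V)
    moreover have "parcs (cce_graph D) \<subseteq> K \<times> K - Id"
      by (auto simp: cce_graph_def out_neighbors_def in_neighbors_def intro: K)
    ultimately show "parcs (cce_graph D) = K \<times> K - Id" by blast
  qed (fact V)
qed

theorem theorem1p3:
  fixes G :: "'a pair_pre_digraph"
  assumes "pair_graph G"
  shows "((\<exists>D. pair_fin_digraph D \<and> semiorder D \<and> G = cce_graph D) \<longleftrightarrow>
          (\<exists>D. pair_fin_digraph D \<and> interval_order D \<and> G = cce_graph D)) \<and>
         ((\<exists>D. pair_fin_digraph D \<and> interval_order D \<and> G = cce_graph D) \<longleftrightarrow>
          (\<exists>r q :: nat. (r \<ge> 2 \<longrightarrow> q \<ge> 2) \<and>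
            digraph_iso (with_proj G)
              (with_proj (disjoint_union (complete_graph r) (edgeless_graph q)))))"
    (is "(?a \<longleftrightarrow> ?b) \<and> (?b \<longleftrightarrow> ?c)")
proof -
  interpret pair_graph G by fact
  have fin: "pair_fin_digraph G" by unfold_locales
  \<comment> \<open>The numbers \<open>r\<close> and \<open>q\<close> disappear, being the sizes of
    \<open>K\<close> and its complement. The equivalences then follow from the cycle (a), (b), (c),
    (a).\<close>
  have c: "?c \<longleftrightarrow> (\<exists>K\<subseteq>pverts G. parcs G = K \<times> K - Id \<and>
      (2 \<le> card K \<longrightarrow> 2 \<le> card (pverts G - K)))"
    unfolding digraph_iso_clique_isolated_iff[OF fin] by blast
  have "?a \<Longrightarrow> ?b"
    using semiorder_imp_interval_order by blast
  moreover have ?c if ?b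
  proof -
    from that obtain D where D: "pair_fin_digraph D" "interval_order D" and G: "G = cce_graph D"
      by blast
    have V: "pverts G = pverts D" by (simp add: G cce_graph_def)
    obtain K where "K \<subseteq> pverts D" "parcs G = K \<times> K - Id"
      "2 \<le> card K \<longrightarrow> 2 \<le> card (pverts D - K)"
      using cce_graph_interval_order[OF D] unfolding G .
    then show ?c
      unfolding c V by blast
  qed
  moreover have ?a if ?c
  proof -
    from that obtain K where K: "K \<subseteq> pverts G" "2 \<le> card K \<longrightarrow> 2 \<le> card (pverts G - K)"
      and A: "parcs G = K \<times> K - Id"
      unfolding c by blast
    from semiorder_realization[OF pair_finite_verts K] obtain D where
      "pair_fin_digraph D" "semiorder D" "pverts D = pverts G" "parcs (cce_graph D) = K \<times> K - Id"
      by blast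
    moreover from this have "G = cce_graph D"
      using A by (simp add: cce_graph_def)
    ultimately show ?a by blast
  qed
  ultimately show ?thesis by blast
qed

end
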